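(* There exists a function $f(k)\in \mathcal{O}(\sqrt{k})$ such that every graph $G$ with feedback edge number $k$ has twin-width at most $f(k)$.
   Context: The feedback edge number of a graph $G$ is the minimum size of an edge set $F$ such that $G-F$ is acyclic. A trigraph is a graph whose edge set is partitioned into black and red edges; a graph is viewed as a trigraph with only black edges. Contracting two distinct vertices $u,v$ of a trigraph produces a new trigraph by removing $u,v$ and adding a new vertex $w$, with a black edge $wx$ for each $x$ such that $xu$ and $xv$ are both black edges, and a red edge $wy$ for each $y$ such that $yu$ or $yv$ is red, or $y$ has a black edge to exactly one of $u,v$. A contraction sequence of a trigraph $G$ is a sequence of trigraphs starting at $G$, each obtained from the previous by one contraction, ending with a single-vertex trigraph. Its width is the maximum red degree (number of incident red edges) of any vertex in any trigraph of the sequence. The twin-width of $G$ is the minimum width of a contraction sequence of $G$. *)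

theory Defs
  imports Complex_Main "HOL-Library.Landau_Symbols"
begin

definition simple_graph :: "'a set \<Rightarrow> 'a set set \<Rightarrow> bool" where
  "simple_graph V E \<longleftrightarrow> finite V \<and> (\<forall>e\<in>E. e \<subseteq> V \<and> card e = 2)"

definition is_cycle :: "'a set set \<Rightarrow> 'a list \<Rightarrow> bool" where
  "is_cycle E p \<longleftrightarrow> length p \<ge> 3 \<and> distinct p \<and>
     (\<forall>i. Suc i < length p \<longrightarrow> {p ! i, p ! Suc i} \<in> E) \<and> {last p, hd p} \<in> E"

definition acyclic_edges :: "'a set set \<Rightarrow> bool" where
  "acyclic_edges E \<longleftrightarrow> (\<nexists>p. is_cycle E p)"

text \<open>Isolated vertices do not matter here, so the edge set alone determines the parameter.\<close>

definition feedback_edge_number :: "'a set set \<Rightarrow> nat" where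
  "feedback_edge_number E = (LEAST k. \<exists>F\<subseteq>E. acyclic_edges (E - F) \<and> card F = k)"

record 'a trigraph =
  verts :: "'a set"
  black :: "'a set set"
  red :: "'a set set"

definition wf_trigraph :: "'a trigraph \<Rightarrow> bool" where
  "wf_trigraph T \<longleftrightarrow> simple_graph (verts T) (black T \<union> red T) \<and> black T \<inter> red T = {}"

definition trigraph_of :: "'a set \<Rightarrow> 'a set set \<Rightarrow> 'a trigraph" where
  "trigraph_of V E = \<lparr>verts = V, black = E, red = {}\<rparr>"

definition contract :: "'a \<Rightarrow> 'a \<Rightarrow> 'a \<Rightarrow> 'a trigraph \<Rightarrow> 'a trigraph" where
  "contract u v w T = (let R = verts T - {u, v} in
     \<lparr>verts = insert w R,
      black = {e \<in> black T. e \<subseteq> R} \<union>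
        {{w, x} |x. x \<in> R \<and> {x, u} \<in> black T \<and> {x, v} \<in> black T},
      red = {e \<in> red T. e \<subseteq> R} \<union>
        {{w, y} |y. y \<in> R \<and> ({y, u} \<in> red T \<or> {y, v} \<in> red T \<or>
           ({y, u} \<in> black T) \<noteq> ({y, v} \<in> black T))}\<rparr>)"

text \<open>
  The contracted vertex \<open>w\<close> only has to be new once \<open>u\<close> and \<open>v\<close> are gone. Permitting
  \<open>w \<in> {u, v}\<close> merely reuses a name, which changes nothing up to isomorphism, and guarantees
  that contractions exist even when the vertex type is finite.
\<close>

definition contraction :: "'a trigraph \<Rightarrow> 'a trigraph \<Rightarrow> bool" where
  "contraction T T' \<longleftrightarrow> (\<exists>u v w. u \<in> verts T \<and> v \<in> verts T \<and> u \<noteq> v \<and>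
     w \<notin> verts T - {u, v} \<and> T' = contract u v w T)"

definition contraction_sequence :: "'a trigraph \<Rightarrow> 'a trigraph list \<Rightarrow> bool" where
  "contraction_sequence T Ts \<longleftrightarrow> Ts \<noteq> [] \<and> hd Ts = T \<and>
     (\<forall>i. Suc i < length Ts \<longrightarrow> contraction (Ts ! i) (Ts ! Suc i)) \<and>
     card (verts (last Ts)) = 1"

definition red_degree :: "'a trigraph \<Rightarrow> 'a \<Rightarrow> nat" where
  "red_degree T v = card {e \<in> red T. v \<in> e}"

definition width :: "'a trigraph list \<Rightarrow> nat" where
  "width Ts = Max {red_degree T v |T v. T \<in> set Ts \<and> v \<in> verts T}"

text \<open>Meaningful only for finite nonempty trigraphs, since only these have a contraction sequence.\<close>

definition twin_width :: "'a trigraph \<Rightarrow> nat" where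
  "twin_width T = (LEAST d. \<exists>Ts. contraction_sequence T Ts \<and> width Ts = d)"


lemma simple_graph_finite_edges: "simple_graph V E \<Longrightarrow> finite E"
  unfolding simple_graph_def by (meson Pow_iff finite_Pow_iff rev_finite_subset subsetI)

lemma feedback_edge_number_attained:
  "\<exists>F\<subseteq>E. acyclic_edges (E - F) \<and> card F = feedback_edge_number E"
proof -
  have "acyclic_edges (E - E)"
    unfolding acyclic_edges_def is_cycle_def by auto
  then have "\<exists>k. \<exists>F\<subseteq>E. acyclic_edges (E - F) \<and> card F = k" by blast
  then show ?thesis unfolding feedback_edge_number_def by (rule LeastI_ex)
qed

lemma wf_trigraph_of: "simple_graph V E \<Longrightarrow> wf_trigraph (trigraph_of V E)"
  by (simp add: wf_trigraph_def trigraph_of_def)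

lemma wf_contraction:
  assumes "wf_trigraph T" "contraction T T'"
  shows "wf_trigraph T'"
proof -
  obtain u v w where uvw: "u \<in> verts T" "v \<in> verts T" "u \<noteq> v" "w \<notin> verts T - {u, v}"
      and T': "T' = contract u v w T"
    using assms(2) unfolding contraction_def by blast
  have sg: "simple_graph (verts T') (black T' \<union> red T')"
    using assms(1) uvw unfolding T' wf_trigraph_def simple_graph_def contract_def Let_def
    by (auto simp: card_insert_if)
  have disj: "\<And>e. e \<in> black T \<Longrightarrow> e \<notin> red T"
    using assms(1) unfolding wf_trigraph_def by blast
  have "False" if e: "e \<in> black T'" "e \<in> red T'" for e
  proof (cases "w \<in> e")
    case True
    then obtain x where x: "e = {w, x}" "{x, u} \<in> black T" "{x, v} \<in> black T"
      using e(1) uvw(4) unfolding T' contract_def Let_def by auto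
    obtain y where y: "e = {w, y}" "{y, u} \<in> red T \<or> {y, v} \<in> red T \<or>
        ({y, u} \<in> black T) \<noteq> ({y, v} \<in> black T)"
      using e(2) True uvw(4) unfolding T' contract_def Let_def by auto
    have "x = y" using x(1) y(1) by (metis doubleton_eq_iff)
    with x y(2) disj show False by blast
  next
    case False
    with e disj show False unfolding T' contract_def Let_def by auto
  qed
  with sg show ?thesis unfolding wf_trigraph_def by blast
qed

lemma contraction_sequence_exists:
  assumes "finite (verts T)" "verts T \<noteq> {}"
  shows "\<exists>Ts. contraction_sequence T Ts"
  using assms
proof (induction "card (verts T)" arbitrary: T rule: less_induct)
  case less
  show ?case
  proof (cases "card (verts T) = 1")
    case True
    then have "contraction_sequence T [T]" by (simp add: contraction_sequence_def)
    then show ?thesis by blast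
  next
    case False
    obtain u where u: "u \<in> verts T" using less.prems by blast
    have "verts T \<noteq> {u}" using False by auto
    then obtain v where v: "v \<in> verts T" "u \<noteq> v" using u by blast
    define T' where "T' = contract u v u T"
    have c: "contraction T T'" using u v unfolding contraction_def T'_def by blast
    have V': "verts T' = verts T - {v}" using u v by (auto simp: T'_def contract_def Let_def)
    have "card (verts T') < card (verts T)"
      unfolding V' by (rule card_Diff1_less[OF less.prems(1) v(1)])
    moreover have "finite (verts T')" unfolding V' using less.prems(1) by (rule finite_Diff)
    moreover have "verts T' \<noteq> {}" unfolding V' using u v(2) by blast
    ultimately obtain Ts where Ts: "contraction_sequence T' Ts" using less.hyps by blast
    have "contraction_sequence T (T # Ts)"
      unfolding contraction_sequence_def
    proof (intro conjI allI impI)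
      fix i assume i: "Suc i < length (T # Ts)"
      show "contraction ((T # Ts) ! i) ((T # Ts) ! Suc i)"
      proof (cases i)
        case 0
        then show ?thesis using Ts c by (auto simp: contraction_sequence_def simp flip: hd_conv_nth)
      next
        case (Suc j)
        then show ?thesis using Ts i by (simp add: contraction_sequence_def)
      qed
    qed (use Ts in \<open>simp_all add: contraction_sequence_def\<close>)
    then show ?thesis by blast
  qed
qed

lemma twin_width_attained:
  assumes "finite (verts T)" "verts T \<noteq> {}"
  shows "\<exists>Ts. contraction_sequence T Ts \<and> width Ts = twin_width T"
proof -
  have "\<exists>d Ts. contraction_sequence T Ts \<and> width Ts = d"
    using contraction_sequence_exists[OF assms] by blast
  then show ?thesis unfolding twin_width_def by (rule LeastI_ex)
qed

end

theory Submission
  imports Defs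
begin

text \<open>
  Call a trigraph \<open>k\<close>-sparse if every vertex set \<open>S\<close> spans at most \<open>card S + k\<close> edges, black or
  red; a graph with feedback edge number \<open>k\<close> is \<open>k\<close>-sparse.  As long as all vertices meeting a red
  edge have degree at most 3, two vertices can be contracted without losing this property if they
  have few neighbours in total and all their private neighbours have degree at most 3; if they are
  also adjacent, have a common neighbour or are both isolated, \<open>k\<close>-sparseness survives as well.
  When no such pair is left, pendant trees have shrunk to paths with at most two edges, at most one
  per vertex, and chains of degree-2 vertices have bounded length, so only \<open>O(k)\<close> vertices and
  edges remain.

  A trigraph with \<open>m\<close> edges and bounded red degree is then contracted with red degree
  \<open>O(sqrt m)\<close>: gather the vertices, one group at a time, into groups of total degree about
  \<open>sqrt m\<close>.  A group has at most as many neighbours as its total degree, and all other vertices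
  see few red edges because there are only \<open>O(sqrt m)\<close> groups.
\<close>

section \<open>Neighbourhoods and their change under a contraction\<close>

definition nbrs :: "'a trigraph \<Rightarrow> 'a \<Rightarrow> 'a set" where
  "nbrs T x = {y. {x, y} \<in> black T \<union> red T}"

definition red_nbrs :: "'a trigraph \<Rightarrow> 'a \<Rightarrow> 'a set" where
  "red_nbrs T x = {y. {x, y} \<in> red T}"

lemma nbrs_sym: "y \<in> nbrs T x \<longleftrightarrow> x \<in> nbrs T y"
  by (simp add: nbrs_def insert_commute)

lemma red_nbrs_sym: "y \<in> red_nbrs T x \<longleftrightarrow> x \<in> red_nbrs T y"
  by (simp add: red_nbrs_def insert_commute)

lemma red_nbrs_subset: "red_nbrs T x \<subseteq> nbrs T x"
  by (auto simp: nbrs_def red_nbrs_def)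

context
  fixes T :: "'a trigraph"
  assumes wf: "wf_trigraph T"
begin

lemma finite_verts: "finite (verts T)"
  using wf by (simp add: wf_trigraph_def simple_graph_def)

lemma edge_verts:
  assumes "{x, y} \<in> black T \<union> red T"
  shows "x \<in> verts T \<and> y \<in> verts T \<and> x \<noteq> y"
proof -
  have "{x, y} \<subseteq> verts T \<and> card {x, y} = 2"
    using wf assms unfolding wf_trigraph_def simple_graph_def by blast
  then show ?thesis by auto
qed

lemma nbrs_irrefl: "x \<notin> nbrs T x"
  using edge_verts[of x x] by (auto simp: nbrs_def)

lemma nbrs_verts: "y \<in> nbrs T x \<Longrightarrow> x \<in> verts T \<and> y \<in> verts T"
  using edge_verts[of x y] by (simp add: nbrs_def)

lemma red_nbrs_verts: "y \<in> red_nbrs T x \<Longrightarrow> x \<in> verts T \<and> y \<in> verts T"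
  using red_nbrs_subset[of T x] nbrs_verts[of y x] by auto

lemma finite_nbrs: "finite (nbrs T x)"
proof (rule finite_subset)
  show "nbrs T x \<subseteq> verts T" using nbrs_verts by blast
qed (rule finite_verts)

lemma finite_red_nbrs: "finite (red_nbrs T x)"
  using finite_nbrs red_nbrs_subset by (rule rev_finite_subset)

lemma red_degree_eq: "red_degree T x = card (red_nbrs T x)"
proof -
  have "{e \<in> red T. x \<in> e} = (\<lambda>y. {x, y}) ` red_nbrs T x" (is "?L = ?R")
  proof
    show "?L \<subseteq> ?R"
    proof
      fix e assume e: "e \<in> ?L"
      then have "card e = 2" using wf by (simp add: wf_trigraph_def simple_graph_def)
      then obtain y where "e = {x, y}" using e by (auto simp: card_2_iff)
      then show "e \<in> ?R" using e by (auto simp: red_nbrs_def)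
    qed
  qed (auto simp: red_nbrs_def)
  moreover have "inj_on (\<lambda>y. {x, y}) (red_nbrs T x)"
    by (auto simp: inj_on_def doubleton_eq_iff)
  ultimately show ?thesis by (simp add: red_degree_def card_image)
qed

end

context
  fixes T :: "'a trigraph" and u v :: 'a
  assumes wf: "wf_trigraph T" and u: "u \<in> verts T" and v: "v \<in> verts T" and uv: "u \<noteq> v"
begin

text \<open>The new vertex always reuses the name \<open>u\<close>, so vertex sets only shrink and a
  set of surviving vertices keeps its meaning after the contraction.\<close>

lemma verts_contract: "verts (contract u v u T) = verts T - {v}"
  using u v uv by (auto simp: contract_def Let_def)

lemma contraction_contract: "contraction T (contract u v u T)"
  using u v uv by (auto simp: contraction_def)

lemma wf_contract: "wf_trigraph (contract u v u T)"
  using wf_contraction[OF wf contraction_contract] .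

lemma black_contract_new:
  "{u, y} \<in> black (contract u v u T) \<longleftrightarrow> y \<notin> {u, v} \<and> {u, y} \<in> black T \<and> {v, y} \<in> black T"
proof -
  have "{u, y} \<in> black (contract u v u T) \<longleftrightarrow>
      (\<exists>z. {u, y} = {u, z} \<and> z \<in> verts T - {u, v} \<and> {z, u} \<in> black T \<and> {z, v} \<in> black T)"
    by (auto simp: contract_def Let_def)
  also have "\<dots> \<longleftrightarrow> y \<in> verts T - {u, v} \<and> {y, u} \<in> black T \<and> {y, v} \<in> black T"
    unfolding doubleton_eq_iff by blast
  also have "\<dots> \<longleftrightarrow> y \<notin> {u, v} \<and> {u, y} \<in> black T \<and> {v, y} \<in> black T"
    unfolding insert_commute[of y] using edge_verts[OF wf, of u y] by blast
  finally show ?thesis .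
qed

lemma red_contract_new:
  "{u, y} \<in> red (contract u v u T) \<longleftrightarrow> y \<notin> {u, v} \<and>
    ({u, y} \<in> red T \<or> {v, y} \<in> red T \<or> ({u, y} \<in> black T) \<noteq> ({v, y} \<in> black T))"
proof -
  have "{u, y} \<in> red (contract u v u T) \<longleftrightarrow>
      (\<exists>z. {u, y} = {u, z} \<and> z \<in> verts T - {u, v} \<and>
        ({z, u} \<in> red T \<or> {z, v} \<in> red T \<or> ({z, u} \<in> black T) \<noteq> ({z, v} \<in> black T)))"
    by (auto simp: contract_def Let_def)
  also have "\<dots> \<longleftrightarrow> y \<in> verts T - {u, v} \<and>
      ({y, u} \<in> red T \<or> {y, v} \<in> red T \<or> ({y, u} \<in> black T) \<noteq> ({y, v} \<in> black T))"
    unfolding doubleton_eq_iff by blast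
  also have "\<dots> \<longleftrightarrow> y \<notin> {u, v} \<and>
      ({u, y} \<in> red T \<or> {v, y} \<in> red T \<or> ({u, y} \<in> black T) \<noteq> ({v, y} \<in> black T))"
    unfolding insert_commute[of y] using edge_verts[OF wf, of u y] edge_verts[OF wf, of v y] by blast
  finally show ?thesis .
qed

lemma contract_old:
  assumes "x \<notin> {u, v}" "y \<notin> {u, v}"
  shows "{x, y} \<in> black (contract u v u T) \<longleftrightarrow> {x, y} \<in> black T"
    and "{x, y} \<in> red (contract u v u T) \<longleftrightarrow> {x, y} \<in> red T"
  using assms edge_verts[OF wf, of x y] by (auto simp: contract_def Let_def doubleton_eq_iff)

lemma nbrs_contract_new: "nbrs (contract u v u T) u = nbrs T u \<union> nbrs T v - {u, v}"
  using black_contract_new red_contract_new by (auto simp: nbrs_def)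

lemma nbrs_contract_old:
  "x \<notin> {u, v} \<Longrightarrow> y \<notin> {u, v} \<Longrightarrow> y \<in> nbrs (contract u v u T) x \<longleftrightarrow> y \<in> nbrs T x"
  by (simp add: nbrs_def contract_old)

text \<open>The new adjacency is the image of the old one under the renaming of \<open>v\<close> to
  \<open>u\<close>, with loops dropped.\<close>

lemma nbrs_contract:
  "y \<in> nbrs (contract u v u T) x \<longleftrightarrow> x \<noteq> v \<and> y \<noteq> v \<and> x \<noteq> y \<and>
     (y \<in> nbrs T x \<or> x = u \<and> y \<in> nbrs T v \<or> y = u \<and> v \<in> nbrs T x)"
proof (cases "x = v \<or> y = v \<or> x = y")
  case True
  then show ?thesis
    using nbrs_irrefl[OF wf_contract] nbrs_verts[OF wf_contract, of y x]
    by (auto simp: verts_contract)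
next
  case False
  then consider "x = u" | "y = u" | "x \<notin> {u, v}" "y \<notin> {u, v}" by blast
  then show ?thesis
  proof cases
    case 1
    then show ?thesis using False by (auto simp: nbrs_contract_new)
  next
    case 2
    then have "y \<in> nbrs (contract u v u T) x \<longleftrightarrow> x \<in> nbrs T u \<or> x \<in> nbrs T v"
      using False by (subst nbrs_sym) (simp add: nbrs_contract_new)
    also have "\<dots> \<longleftrightarrow> u \<in> nbrs T x \<or> v \<in> nbrs T x" by (simp only: nbrs_sym[of x])
    finally show ?thesis using False 2 by simp
  next
    case 3
    then show ?thesis using False by (auto simp: nbrs_contract_old)
  qed
qed

lemma red_nbrs_contract_old:
  "x \<notin> {u, v} \<Longrightarrow> y \<notin> {u, v} \<Longrightarrow> y \<in> red_nbrs (contract u v u T) x \<longleftrightarrow> y \<in> red_nbrs T x"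
  by (simp add: red_nbrs_def contract_old)

text \<open>If neither edge to \<open>y\<close> is red, a black edge to exactly one of
  \<open>u\<close>, \<open>v\<close> means adjacency to exactly one, so the last alternative can
  forget colours.\<close>

lemma red_nbrs_contract_new:
  assumes "y \<in> red_nbrs (contract u v u T) u"
  shows "y \<notin> {u, v} \<and> (y \<in> red_nbrs T u \<or> y \<in> red_nbrs T v \<or> (y \<in> nbrs T u) \<noteq> (y \<in> nbrs T v))"
  using assms red_contract_new[of y] unfolding red_nbrs_def nbrs_def by blast

text \<open>Renaming \<open>v\<close> to \<open>u\<close> in the old neighbourhood covers the new
  one, so only the merged vertex can gain degree.\<close>

lemma card_nbrs_contract_old:
  assumes "x \<noteq> u"
  shows "card (nbrs (contract u v u T) x) \<le> card (nbrs T x)"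
proof -
  have "nbrs (contract u v u T) x \<subseteq> (\<lambda>y. if y = v then u else y) ` nbrs T x"
    using assms by (auto simp: nbrs_contract image_iff)
  then show ?thesis by (rule surj_card_le[OF finite_nbrs[OF wf]])
qed

end

section \<open>Red-degree bounds along a contraction sequence\<close>

lemma card_le_1I:
  assumes "\<And>x y. x \<in> A \<Longrightarrow> y \<in> A \<Longrightarrow> x = y"
  shows "card A \<le> 1"
proof (cases "A = {}")
  case False
  then obtain x where "x \<in> A" by blast
  then have "A = {x}" using assms by blast
  then show ?thesis by simp
qed simp

text \<open>The pointwise bound avoids the maximum in \<open>width\<close>, so it extends directly
  when a contraction is put in front.\<close>

definition tww_le :: "nat \<Rightarrow> 'a trigraph \<Rightarrow> bool" where
  "tww_le d T \<longleftrightarrow>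
     (\<exists>Ts. contraction_sequence T Ts \<and> (\<forall>T'\<in>set Ts. \<forall>x\<in>verts T'. red_degree T' x \<le> d))"

lemma twin_width_le:
  assumes "tww_le d T"
  shows "twin_width T \<le> d"
proof -
  obtain Ts where Ts: "contraction_sequence T Ts"
    and d: "\<And>T' x. T' \<in> set Ts \<Longrightarrow> x \<in> verts T' \<Longrightarrow> red_degree T' x \<le> d"
    using assms unfolding tww_le_def by blast
  let ?A = "{red_degree T v |T v. T \<in> set Ts \<and> v \<in> verts T}"
  \<comment> \<open>\<open>Max\<close> needs a finite nonempty set: finiteness comes from the bound
    \<open>d\<close>, nonemptiness from the vertex of the last trigraph.\<close>
  have "?A \<subseteq> {..d}" using d by auto
  then have fin: "finite ?A" by (rule finite_subset) simp
  have "last Ts \<in> set Ts" "verts (last Ts) \<noteq> {}"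
    using Ts by (auto simp: contraction_sequence_def)
  then have "?A \<noteq> {}" by blast
  then have "width Ts \<le> d" unfolding width_def using fin d by (subst Max_le_iff) auto
  moreover have "twin_width T \<le> width Ts"
    unfolding twin_width_def using Ts by (intro Least_le) blast
  ultimately show ?thesis by simp
qed

lemma tww_le_step:
  assumes "\<And>x. x \<in> verts T \<Longrightarrow> red_degree T x \<le> d" "contraction T T'" "tww_le d T'"
  shows "tww_le d T"
proof -
  obtain Ts where Ts: "contraction_sequence T' Ts"
    and d: "\<forall>T'\<in>set Ts. \<forall>x\<in>verts T'. red_degree T' x \<le> d"
    using assms(3) unfolding tww_le_def by blast
  have "contraction_sequence T (T # Ts)"
    unfolding contraction_sequence_def
  proof (intro conjI allI impI)
    fix i assume i: "Suc i < length (T # Ts)"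
    show "contraction ((T # Ts) ! i) ((T # Ts) ! Suc i)"
    proof (cases i)
      case 0
      then show ?thesis
        using Ts assms(2) by (auto simp: contraction_sequence_def simp flip: hd_conv_nth)
    next
      case (Suc j)
      then show ?thesis using Ts i by (simp add: contraction_sequence_def)
    qed
  qed (use Ts in \<open>simp_all add: contraction_sequence_def\<close>)
  then show ?thesis unfolding tww_le_def using d assms(1) by (metis set_ConsD)
qed

text \<open>Any order of contractions works, since a red degree never exceeds the number of
  vertices, which only decreases.\<close>

lemma tww_le_small:
  assumes "wf_trigraph T" "verts T \<noteq> {}" "card (verts T) \<le> d"
  shows "tww_le d T"
  using assms
proof (induction "card (verts T)" arbitrary: T rule: less_induct)
  case less
  have fin: "finite (verts T)" by (rule finite_verts[OF less.prems(1)])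
  have rd: "red_degree T x \<le> d" for x
  proof -
    have "red_nbrs T x \<subseteq> verts T" using red_nbrs_verts[OF less.prems(1)] by blast
    then have "card (red_nbrs T x) \<le> card (verts T)" by (rule card_mono[OF fin])
    then show ?thesis using less.prems(3) by (simp add: red_degree_eq[OF less.prems(1)])
  qed
  show ?case
  proof (cases "card (verts T) = 1")
    case True
    then have "contraction_sequence T [T]" by (simp add: contraction_sequence_def)
    then show ?thesis unfolding tww_le_def using rd by (metis empty_iff empty_set set_ConsD)
  next
    case False
    obtain u where u: "u \<in> verts T" using less.prems by blast
    have "verts T \<noteq> {u}" using False by auto
    then obtain v where v: "v \<in> verts T" "u \<noteq> v" using u by blast
    note uv = less.prems(1) u v
    let ?T = "contract u v u T"
    have "card (verts ?T) < card (verts T)"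
      unfolding verts_contract[OF uv] using fin v(1) by (rule card_Diff1_less)
    moreover have "verts ?T \<noteq> {}" unfolding verts_contract[OF uv] using u v by blast
    ultimately have "tww_le d ?T"
      using less.hyps[of ?T] wf_contract[OF uv] less.prems(3) by simp
    then show ?thesis using rd by (intro tww_le_step[OF _ contraction_contract[OF uv]])
  qed
qed

section \<open>Contracting trigraphs with few edges\<close>

text \<open>
  \<open>N\<close> holds the groups formed so far and \<open>wt\<close> the sum of the initial degrees in a group.  The only
  group of weight at most \<open>s\<close> is the one being filled.
\<close>

lemma tww_le_grouping:
  fixes wt :: "'a \<Rightarrow> nat"
  assumes "wf_trigraph T" "verts T \<noteq> {}"
    and "\<And>x. x \<in> verts T \<Longrightarrow> card (nbrs T x) \<le> wt x"
    and "(\<Sum>x\<in>verts T. wt x) \<le> s * q"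
    and "N \<subseteq> verts T" "\<And>x. x \<in> N \<Longrightarrow> wt x \<le> 2 * s"
    and "\<And>x y. x \<in> N \<Longrightarrow> y \<in> N \<Longrightarrow> wt x \<le> s \<Longrightarrow> wt y \<le> s \<Longrightarrow> x = y"
    and "\<And>x. x \<in> verts T - N \<Longrightarrow> card (red_nbrs T x - N) \<le> c"
    and s: "s > 0" and d: "2 * s \<le> d" "c + q + 1 \<le> d"
  shows "tww_le d T"
  using assms(1-8)
proof (induction "card (verts T)" arbitrary: T N wt rule: less_induct)
  case less
  note wf = less.prems(1) and nonempty = less.prems(2) and deg = less.prems(3)
    and sum = less.prems(4) and N = less.prems(5-7) and rdN = less.prems(8)
  have fin: "finite (verts T)" by (rule finite_verts[OF wf])
  have finN: "finite N" using N(1) fin by (rule finite_subset)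
  \<comment> \<open>Each heavy vertex uses more than \<open>s\<close> of a total weight of at most
    \<open>s * q\<close>, so there are at most \<open>q\<close> of them.\<close>
  let ?H = "{x \<in> verts T. s < wt x}"
  have "card ?H * s \<le> (\<Sum>x\<in>?H. wt x)" using sum_bounded_below[of ?H s wt] by simp
  also have "\<dots> \<le> (\<Sum>x\<in>verts T. wt x)" using fin by (intro sum_mono2) auto
  also have "\<dots> \<le> q * s" using sum by (simp add: mult.commute)
  finally have H: "card ?H \<le> q" using s by simp
  \<comment> \<open>A group has at most \<open>2 * s\<close> neighbours. Any other vertex has at
    most \<open>c\<close> red neighbours outside the groups, and there are at most \<open>q\<close>
    heavy groups and one light one.\<close>
  have rd: "red_degree T x \<le> d" if x: "x \<in> verts T" for x
  proof (cases "x \<in> N")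
    case True
    have "card (red_nbrs T x) \<le> card (nbrs T x)"
      by (rule card_mono[OF finite_nbrs[OF wf] red_nbrs_subset])
    then show ?thesis using deg[OF x] N(2)[OF True] d by (simp add: red_degree_eq[OF wf])
  next
    case False
    have "N \<subseteq> ?H \<union> {y \<in> N. wt y \<le> s}" using N(1) by auto
    then have "card N \<le> card (?H \<union> {y \<in> N. wt y \<le> s})"
      using fin finN by (intro card_mono) auto
    also have "\<dots> \<le> card ?H + card {y \<in> N. wt y \<le> s}" by (rule card_Un_le)
    also have "\<dots> \<le> q + 1" using H card_le_1I[of "{y \<in> N. wt y \<le> s}"] N(3) by fastforce
    finally have "card N \<le> q + 1" .
    moreover have "card (red_nbrs T x) \<le> card ((red_nbrs T x - N) \<union> N)"
      using finite_red_nbrs[OF wf] finN by (intro card_mono) auto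
    then have "card (red_nbrs T x) \<le> card (red_nbrs T x - N) + card N"
      using card_Un_le le_trans by blast
    ultimately show ?thesis using rdN[of x] x False d by (simp add: red_degree_eq[OF wf])
  qed
  let ?L = "{x \<in> verts T. wt x \<le> s}"
  show ?case
  proof (cases "\<forall>x\<in>?L. \<forall>y\<in>?L. x = y")
    case True
    \<comment> \<open>Nothing is left to merge: at most \<open>q\<close> heavy vertices and one
      light vertex remain, so every further contraction is cheap.\<close>
    then have "card ?L \<le> 1" by (intro card_le_1I) blast
    moreover have "card (verts T) \<le> card (?H \<union> ?L)" using fin by (intro card_mono) auto
    then have "card (verts T) \<le> card ?H + card ?L" using card_Un_le le_trans by blast
    ultimately show ?thesis using H d by (intro tww_le_small[OF wf nonempty]) simp
  next
    case False
    \<comment> \<open>\<open>u\<close> is the group being filled, or a light vertex that starts a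
      new one if all groups are heavy; \<open>v\<close> is a light vertex outside the groups. Two
      light weights add up to at most \<open>2 * s\<close>, and heavy vertices are never
      merged.\<close>
    have "\<exists>u\<in>?L. \<exists>v\<in>?L. u \<noteq> v \<and> v \<notin> N \<and> (\<forall>y\<in>N. wt y \<le> s \<longrightarrow> y = u)"
    proof (cases "\<exists>u\<in>N. wt u \<le> s")
      case True
      then obtain u where u: "u \<in> N" "wt u \<le> s" by blast
      then have "u \<in> ?L" using N(1) by auto
      then obtain v where "v \<in> ?L" "v \<noteq> u" using False by blast
      moreover have only: "\<forall>y\<in>N. wt y \<le> s \<longrightarrow> y = u" using N(3) u by blast
      ultimately have "v \<notin> N" by auto
      show ?thesis
        by (intro bexI[of _ u] bexI[of _ v] conjI not_sym[OF \<open>v \<noteq> u\<close>]) fact+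
    next
      case noN: False
      obtain u v where uv: "u \<in> ?L" "v \<in> ?L" "u \<noteq> v" using False by blast
      moreover have "v \<notin> N" using noN uv(2) by blast
      ultimately show ?thesis
        using noN by (intro bexI[of _ u] bexI[of _ v] conjI) auto
    qed
    then obtain u v where u: "u \<in> verts T" "wt u \<le> s" and v: "v \<in> verts T" "wt v \<le> s"
      and uv: "u \<noteq> v" and vN: "v \<notin> N" and uN: "\<And>y. y \<in> N \<Longrightarrow> wt y \<le> s \<Longrightarrow> y = u" by blast
    note c = wf u(1) v(1) uv
    let ?T = "contract u v u T" and ?w = "wt(u := wt u + wt v)" and ?N = "insert u N"
    have "tww_le d ?T"
    proof (rule less.hyps[of ?T ?w ?N])
      show "card (verts ?T) < card (verts T)"
        unfolding verts_contract[OF c] using fin v(1) by (rule card_Diff1_less)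
      show "wf_trigraph ?T" by (rule wf_contract[OF c])
      show "verts ?T \<noteq> {}" unfolding verts_contract[OF c] using u uv by blast
      show "card (nbrs ?T x) \<le> ?w x" if "x \<in> verts ?T" for x
      proof (cases "x = u")
        case True
        have "card (nbrs ?T u) \<le> card (nbrs T u \<union> nbrs T v)"
          unfolding nbrs_contract_new[OF c] using finite_nbrs[OF wf] by (intro card_mono) auto
        also have "\<dots> \<le> wt u + wt v"
          using card_Un_le[of "nbrs T u" "nbrs T v"] deg[OF u(1)] deg[OF v(1)] by simp
        finally show ?thesis using True by simp
      next
        case False
        then show ?thesis
          using that deg[of x] card_nbrs_contract_old[OF c False]
          by (simp add: verts_contract[OF c])
      qed
      have "(\<Sum>x\<in>verts ?T. ?w x) = ?w u + (\<Sum>x\<in>verts T - {v} - {u}. ?w x)"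
        unfolding verts_contract[OF c] using fin u uv by (intro sum.remove) auto
      also have "(\<Sum>x\<in>verts T - {v} - {u}. ?w x) = (\<Sum>x\<in>verts T - {v} - {u}. wt x)"
        by (intro sum.cong) auto
      also have "?w u + \<dots> = (\<Sum>x\<in>verts T. wt x)"
        using fin u v uv sum.remove[of "verts T" v wt] sum.remove[of "verts T - {v}" u wt] by simp
      finally show "(\<Sum>x\<in>verts ?T. ?w x) \<le> s * q" using sum by simp
      show "?N \<subseteq> verts ?T" unfolding verts_contract[OF c] using N(1) vN u uv by auto
      show "?w x \<le> 2 * s" if "x \<in> ?N" for x using that N(2) u v by auto
      have only: "z = u" if "z \<in> ?N" "?w z \<le> s" for z
        using that uN[of z] by (cases "z = u") auto
      show "x = y" if "x \<in> ?N" "y \<in> ?N" "?w x \<le> s" "?w y \<le> s" for x y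
        using only[OF that(1,3)] only[OF that(2,4)] by (rule trans[OF _ sym])
      \<comment> \<open>New red edges all end in \<open>u\<close>, which now counts as a group, so
        red degrees outside the groups do not grow.\<close>
      show "card (red_nbrs ?T x - ?N) \<le> c" if x: "x \<in> verts ?T - ?N" for x
      proof -
        have "red_nbrs ?T x - ?N \<subseteq> red_nbrs T x - N"
        proof
          fix y assume y: "y \<in> red_nbrs ?T x - ?N"
          then have "y \<in> verts ?T"
            using red_nbrs_verts[OF wf_contract[OF c], of y x] by simp
          then show "y \<in> red_nbrs T x - N"
            using x y red_nbrs_contract_old[OF c, of x y] by (auto simp: verts_contract[OF c])
        qed
        then have "card (red_nbrs ?T x - ?N) \<le> card (red_nbrs T x - N)"
          using finite_red_nbrs[OF wf] by (intro card_mono) auto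
        also have "\<dots> \<le> c" using rdN[of x] x by (auto simp: verts_contract[OF c])
        finally show ?thesis .
      qed
    qed
    then show ?thesis using rd by (intro tww_le_step[OF _ contraction_contract[OF c]])
  qed
qed

section \<open>Contractions that preserve sparseness\<close>

text \<open>Ordered pairs make the count a degree sum and let the renaming of a contraction act
  through \<open>map_prod\<close>.\<close>

definition arcs :: "'a trigraph \<Rightarrow> 'a set \<Rightarrow> ('a \<times> 'a) set" where
  "arcs T S = (SIGMA x:S. nbrs T x \<inter> S)"

text \<open>The hereditary form of \<open>card E \<le> card V + k\<close>; every edge gives two arcs.\<close>

definition sparse :: "nat \<Rightarrow> 'a trigraph \<Rightarrow> bool" where
  "sparse k T \<longleftrightarrow> (\<forall>S\<subseteq>verts T. card (arcs T S) \<le> 2 * card S + 2 * k)"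

text \<open>The total degree is bounded, not only the red one, because later contractions may turn
  black edges red.\<close>

definition tame :: "'a trigraph \<Rightarrow> bool" where
  "tame T \<longleftrightarrow> (\<forall>x. red_nbrs T x \<noteq> {} \<longrightarrow> card (nbrs T x) \<le> 3)"

definition foldable :: "'a trigraph \<Rightarrow> 'a \<Rightarrow> 'a \<Rightarrow> bool" where
  "foldable T u v \<longleftrightarrow> u \<in> verts T \<and> v \<in> verts T \<and> u \<noteq> v \<and>
     card (nbrs T u \<union> nbrs T v - {u, v}) \<le> 3 \<and>
     (\<forall>x. x \<notin> {u, v} \<longrightarrow> (x \<in> nbrs T u) \<noteq> (x \<in> nbrs T v) \<longrightarrow> card (nbrs T x) \<le> 3) \<and>
     (v \<in> nbrs T u \<or> nbrs T u \<inter> nbrs T v \<noteq> {} \<or> nbrs T u = {} \<and> nbrs T v = {})"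

text \<open>A red edge away from \<open>u\<close> is old. One from \<open>x\<close> to
  \<open>u\<close> arises from a red edge at \<open>x\<close> or from \<open>x\<close> being a
  private neighbour of \<open>u\<close> or \<open>v\<close>; either way \<open>x\<close> had degree
  at most 3. The degree of \<open>u\<close> itself is bounded by \<open>foldable\<close>.\<close>

lemma tame_contract:
  assumes wf: "wf_trigraph T" and tame: "tame T" and fold: "foldable T u v"
  shows "tame (contract u v u T)"
  unfolding tame_def
proof (intro allI impI)
  let ?T = "contract u v u T"
  have uv: "u \<in> verts T" "v \<in> verts T" "u \<noteq> v" using fold by (auto simp: foldable_def)
  note c = wf uv
  fix x assume "red_nbrs ?T x \<noteq> {}"
  then obtain y where y: "y \<in> red_nbrs ?T x" by blast
  show "card (nbrs ?T x) \<le> 3"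
  proof (cases "x = u")
    case True
    then show ?thesis using fold by (simp add: nbrs_contract_new[OF c] foldable_def)
  next
    case xu: False
    have "y \<in> nbrs ?T x" using y red_nbrs_subset[of ?T x] by auto
    then have v: "x \<noteq> v" "y \<noteq> v" by (auto simp: nbrs_contract[OF c])
    have "card (nbrs T x) \<le> 3"
    proof (cases "y = u")
      case False
      then have "y \<in> red_nbrs T x" using y xu v red_nbrs_contract_old[OF c] by blast
      then show ?thesis using tame unfolding tame_def by blast
    next
      case True
      then have "x \<in> red_nbrs ?T u" using y red_nbrs_sym by metis
      from red_nbrs_contract_new[OF c this]
      consider "red_nbrs T x \<noteq> {}" | "(x \<in> nbrs T u) \<noteq> (x \<in> nbrs T v)"
        using red_nbrs_sym by fastforce
      then show ?thesis
        using tame fold xu v unfolding tame_def foldable_def by cases blast+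
    qed
    then show ?thesis using card_nbrs_contract_old[OF c xu] by simp
  qed
qed

lemma finite_arcs:
  assumes "wf_trigraph T" "S \<subseteq> verts T"
  shows "finite (arcs T S)"
proof -
  have S: "finite S" using assms(2) finite_verts[OF assms(1)] by (rule finite_subset)
  show ?thesis unfolding arcs_def by (rule finite_SigmaI) (simp_all add: S)
qed

text \<open>A set \<open>S\<close> containing \<open>u\<close> is pulled back by adding
  \<open>v\<close>, and possibly a common neighbour. Each added vertex is paid for by one edge, that
  is two arcs, that the contraction loses.\<close>

lemma sparse_contract:
  assumes wf: "wf_trigraph T" and sp: "sparse k T" and fold: "foldable T u v"
  shows "sparse k (contract u v u T)"
  unfolding sparse_def
proof (intro allI impI)
  let ?T = "contract u v u T"
  let ?f = "\<lambda>x. if x = v then u else x"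
  have uv: "u \<in> verts T" "v \<in> verts T" "u \<noteq> v" using fold by (auto simp: foldable_def)
  note c = wf uv
  fix S assume "S \<subseteq> verts ?T"
  then have S: "S \<subseteq> verts T" "v \<notin> S" by (auto simp: verts_contract[OF c])
  have finS: "finite S" using S finite_verts[OF wf] finite_subset by blast
  show "card (arcs ?T S) \<le> 2 * card S + 2 * k"
  proof (cases "u \<notin> S \<or> nbrs T v = {}")
    case True
    then have "arcs ?T S \<subseteq> arcs T S" by (auto simp: arcs_def nbrs_contract[OF c] nbrs_sym)
    then have "card (arcs ?T S) \<le> card (arcs T S)"
      using finite_arcs[OF wf S(1)] by (rule card_mono[rotated])
    then show ?thesis using sp S(1) unfolding sparse_def by (meson le_trans)
  next
    case False
    then have uS: "u \<in> S" by blast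
    \<comment> \<open>\<open>X\<close> collects the lost arcs: if the remaining arcs of
      \<open>S'\<close> still cover those of \<open>S\<close>, the sparseness of \<open>S'\<close>
      is improved by \<open>card X\<close>.\<close>
    have lift: "card (arcs ?T S) + card X \<le> 2 * card S' + 2 * k"
      if "X \<subseteq> arcs T S'" "S' \<subseteq> verts T" "arcs ?T S \<subseteq> map_prod ?f ?f ` (arcs T S' - X)" for X S'
    proof -
      have fin: "finite (arcs T S')" by (rule finite_arcs[OF wf that(2)])
      have "card (arcs ?T S) \<le> card (arcs T S' - X)"
        using that(3) fin by (intro surj_card_le[where f = "map_prod ?f ?f"]) auto
      then have "card (arcs ?T S) + card X \<le> card (arcs T S')"
        using card_Diff_subset[of X "arcs T S'"] that(1) fin card_mono[OF fin that(1)]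
          finite_subset[OF that(1) fin] by simp
      then show ?thesis using sp that(2) unfolding sparse_def by (meson le_trans)
    qed
    \<comment> \<open>It suffices to replace each arc that does not collapse by an arc outside
      \<open>X\<close> with the same image.\<close>
    have lift_arc: "(a, b) \<in> map_prod ?f ?f ` (arcs T S' - X)"
      if ab: "(a, b) \<in> arcs ?T S" and S': "insert v S \<subseteq> S'"
        and X: "\<And>a b. (a, b) \<in> arcs T (insert v S) \<Longrightarrow> a \<noteq> b \<Longrightarrow> ?f a \<noteq> ?f b \<Longrightarrow>
          \<exists>a' b'. (a', b') \<in> arcs T S' - X \<and> ?f a' = ?f a \<and> ?f b' = ?f b" for a b S' X
    proof -
      have ab': "a \<in> S" "b \<in> S" "b \<in> nbrs ?T a" using ab by (simp_all add: arcs_def)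
      then have ne: "a \<noteq> v" "b \<noteq> v" "a \<noteq> b" by (simp_all add: nbrs_contract[OF c])
      from ab'(3) consider "b \<in> nbrs T a" | "a = u" "b \<in> nbrs T v" | "b = u" "v \<in> nbrs T a"
        unfolding nbrs_contract[OF c] by blast
      then obtain a' b' where "(a', b') \<in> arcs T (insert v S)" "?f a' = a" "?f b' = b"
      proof cases
        case 1
        then show ?thesis using ab'(1,2) ne that[of a b] by (simp add: arcs_def)
      next
        case 2
        then show ?thesis using ab'(1,2) ne that[of v b] by (simp add: arcs_def)
      next
        case 3
        then show ?thesis using ab'(1,2) ne that[of a v] by (simp add: arcs_def)
      qed
      moreover have "a' \<noteq> b'" using calculation ne(3) by blast
      ultimately obtain a'' b'' where "(a'', b'') \<in> arcs T S' - X" "?f a'' = a" "?f b'' = b"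
        using X[of a' b'] ne(3) by auto
      then show ?thesis by force
    qed
    show ?thesis
    proof (cases "v \<in> nbrs T u")
      case True
      let ?X = "{(u, v), (v, u)}"
      have "arcs ?T S \<subseteq> map_prod ?f ?f ` (arcs T (insert v S) - ?X)"
      proof safe
        fix a b assume "(a, b) \<in> arcs ?T S"
        then show "(a, b) \<in> map_prod ?f ?f ` (arcs T (insert v S) - ?X)"
        proof (rule lift_arc)
          fix a b assume ab: "(a, b) \<in> arcs T (insert v S)" "?f a \<noteq> ?f b"
          then have "(a, b) \<notin> ?X" using uv by auto
          show "\<exists>a' b'. (a', b') \<in> arcs T (insert v S) - ?X \<and> ?f a' = ?f a \<and> ?f b' = ?f b"
            by (intro exI[of _ a] exI[of _ b] conjI DiffI refl) fact+
        qed simp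
      qed
      moreover have "?X \<subseteq> arcs T (insert v S)"
        using True uS nbrs_sym by (fastforce simp: arcs_def)
      ultimately have "card (arcs ?T S) + card ?X \<le> 2 * card (insert v S) + 2 * k"
        using lift uv(2) S(1) by simp
      then show ?thesis using S(2) finS uv(3) by simp
    next
      case nadj: False
      then obtain x where x: "x \<in> nbrs T u" "x \<in> nbrs T v"
        using fold False by (auto simp: foldable_def)
      have x': "u \<in> nbrs T x" "v \<in> nbrs T x"
        using iffD1[OF nbrs_sym x(1)] iffD1[OF nbrs_sym x(2)] .
      have xn: "x \<noteq> u" "x \<noteq> v" using x nbrs_irrefl[OF wf] by auto
      have xV: "x \<in> verts T" using nbrs_verts[OF wf x(1)] by simp
      let ?S = "insert v (insert x S)"
      \<comment> \<open>For \<open>x\<close> in \<open>S\<close>, the edges from \<open>x\<close> to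
        \<open>u\<close> and \<open>v\<close> merge, so one is lost for the added \<open>v\<close>.
        Otherwise both are lost, for the two added vertices \<open>v\<close> and
        \<open>x\<close>.\<close>
      let ?X = "{(x, v), (v, x)} \<union> (if x \<in> S then {} else {(x, u), (u, x)})"
      have "arcs ?T S \<subseteq> map_prod ?f ?f ` (arcs T ?S - ?X)"
      proof safe
        fix a b assume "(a, b) \<in> arcs ?T S"
        then show "(a, b) \<in> map_prod ?f ?f ` (arcs T ?S - ?X)"
        proof (rule lift_arc)
          fix a b assume ab: "(a, b) \<in> arcs T (insert v S)" "a \<noteq> b" "?f a \<noteq> ?f b"
          have ux: "(u, x) \<in> arcs T ?S" "(x, u) \<in> arcs T ?S"
            using x x' uS by (auto simp: arcs_def)
          show "\<exists>a' b'. (a', b') \<in> arcs T ?S - ?X \<and> ?f a' = ?f a \<and> ?f b' = ?f b"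
          proof (cases "(a, b) \<in> ?X")
            case False
            then show ?thesis using ab by (intro exI[of _ a] exI[of _ b]) (auto simp: arcs_def)
          next
            case True
            then have xS: "x \<in> S" using ab(1) xn by (auto simp: arcs_def split: if_splits)
            with True consider "a = x" "b = v" | "a = v" "b = x" by auto
            then show ?thesis
            proof cases
              case 1
              then show ?thesis using ux xS xn uv
                by (intro exI[of _ x] exI[of _ u]) auto
            next
              case 2
              then show ?thesis using ux xS xn uv
                by (intro exI[of _ u] exI[of _ x]) auto
            qed
          qed
        qed auto
      qed
      moreover have "?X \<subseteq> arcs T ?S"
        using x x' uS by (auto simp: arcs_def)
      moreover have "?S \<subseteq> verts T" using xV uv(2) S(1) by simp
      ultimately have *: "card (arcs ?T S) + card ?X \<le> 2 * card ?S + 2 * k" using lift by simp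
      show ?thesis
      proof (cases "x \<in> S")
        case True
        then have "?S = insert v S" by auto
        moreover have "card ?X = 2" using True xn by simp
        ultimately show ?thesis using * S(2) finS by simp
      next
        case False
        then have "card ?X = 4" using xn uv by (simp add: card_insert_if)
        moreover have "card ?S = card S + 2" using False S(2) finS xn by simp
        ultimately show ?thesis using * by linarith
      qed
    qed
  qed
qed

section \<open>Irreducible sparse trigraphs\<close>

text \<open>Isolated vertices, leaves and middle vertices of attached two-edge paths: all that
  irreducibility leaves of pendant trees.\<close>

definition pendant :: "'a trigraph \<Rightarrow> 'a \<Rightarrow> bool" where
  "pendant T u \<longleftrightarrow> card (nbrs T u) \<le> 1 \<or>
     card (nbrs T u) = 2 \<and> (\<exists>v\<in>nbrs T u. card (nbrs T v) = 1)"

definition core :: "'a trigraph \<Rightarrow> 'a set" where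
  "core T = {x \<in> verts T. \<not> pendant T x}"

context
  fixes T :: "'a trigraph"
  assumes wf: "wf_trigraph T" and irred: "\<And>u v. \<not> foldable T u v"
begin

lemma mem_core: "x \<in> nbrs T y \<Longrightarrow> x \<in> core T \<longleftrightarrow> \<not> pendant T x"
  using nbrs_verts[OF wf, of x y] by (simp add: core_def)

text \<open>Otherwise the leaf \<open>v\<close> could be folded into \<open>u\<close>: at most three
  other neighbours remain, all of degree at most 3.\<close>

lemma leaf_next_to_big:
  assumes v: "nbrs T v = {u}" and u: "card (nbrs T u) \<le> 4"
  shows "\<exists>y\<in>nbrs T u - {v}. card (nbrs T y) \<ge> 4"
proof (rule ccontr)
  assume "\<not> ?thesis"
  then have small: "card (nbrs T y) \<le> 3" if "y \<in> nbrs T u" "y \<noteq> v" for y using that by force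
  have uv: "u \<in> nbrs T v" "v \<in> nbrs T u" using v nbrs_sym[of u T v] by auto
  have "nbrs T u \<union> nbrs T v - {u, v} = nbrs T u - {v}"
    using v nbrs_irrefl[OF wf, of u] by auto
  moreover have "card (nbrs T u - {v}) \<le> 3"
    using uv(2) u finite_nbrs[OF wf, of u] by (simp add: card_Diff_singleton)
  ultimately have "foldable T u v"
    using small uv nbrs_verts[OF wf uv(2)] nbrs_irrefl[OF wf, of u] v
    unfolding foldable_def by auto
  then show False using irred by blast
qed

lemma pendant_attach:
  assumes u: "pendant T u" and ux: "u \<in> nbrs T x" and x: "card (nbrs T x) \<ge> 2"
  shows "\<exists>v. nbrs T u \<subseteq> {x, v} \<and> card (nbrs T v) \<le> 1"
proof -
  have xu: "x \<in> nbrs T u" using iffD1[OF nbrs_sym ux] .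
  show ?thesis
  proof (cases "card (nbrs T u) \<le> 1")
    case True
    then have "\<forall>y\<in>nbrs T u. y = x"
      using xu finite_nbrs[OF wf, of u] card_le_Suc0_iff_eq by fastforce
    \<comment> \<open>A leaf has no neighbour besides \<open>x\<close>, so \<open>u\<close> itself
      serves as a dummy witness.\<close>
    then show ?thesis using True by (intro exI[of _ u]) auto
  next
    case False
    then obtain v where v: "v \<in> nbrs T u" "card (nbrs T v) = 1" and 2: "card (nbrs T u) = 2"
      using u by (auto simp: pendant_def)
    have "v \<noteq> x" using v(2) x by auto
    then have "card {x, v} = card (nbrs T u)" using 2 by simp
    then have "{x, v} = nbrs T u"
      using xu v(1) finite_nbrs[OF wf] by (intro card_subset_eq) auto
    then show ?thesis using v(2) by (intro exI[of _ v]) auto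
  qed
qed

text \<open>Two pendant vertices at \<open>x\<close> could be folded: they share \<open>x\<close>,
  and each has at most one further neighbour, which has degree at most 1.\<close>

lemma pendant_unique:
  assumes "u \<in> nbrs T x" "v \<in> nbrs T x" "pendant T u" "pendant T v"
  shows "u = v"
proof (rule ccontr)
  assume uv: "u \<noteq> v"
  have "card {u, v} \<le> card (nbrs T x)"
    using assms(1,2) finite_nbrs[OF wf] by (intro card_mono) auto
  then have x: "card (nbrs T x) \<ge> 2" using uv by simp
  obtain a where a: "nbrs T u \<subseteq> {x, a}" "card (nbrs T a) \<le> 1"
    using pendant_attach[OF assms(3,1) x] by blast
  obtain b where b: "nbrs T v \<subseteq> {x, b}" "card (nbrs T b) \<le> 1"
    using pendant_attach[OF assms(4,2) x] by blast
  have xuv: "x \<in> nbrs T u" "x \<in> nbrs T v" using assms(1,2) nbrs_sym by fast+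
  have "card (nbrs T u \<union> nbrs T v - {u, v}) \<le> card {x, a, b}"
    using a(1) b(1) by (intro card_mono) auto
  also have "\<dots> \<le> 3" by (simp add: card_insert_if)
  finally have "card (nbrs T u \<union> nbrs T v - {u, v}) \<le> 3" .
  moreover have "card (nbrs T y) \<le> 3" if "(y \<in> nbrs T u) \<noteq> (y \<in> nbrs T v)" for y
  proof -
    have "y = a \<or> y = b" using that xuv a(1) b(1) by blast
    then show ?thesis using a(2) b(2) by auto
  qed
  ultimately have "foldable T u v"
    using uv xuv nbrs_verts[OF wf xuv(1)] nbrs_verts[OF wf xuv(2)] unfolding foldable_def by blast
  then show False using irred by blast
qed

lemma card_nbrs_diff_core: "card (nbrs T x - core T) \<le> 1"
proof (rule card_le_1I)
  fix u v assume "u \<in> nbrs T x - core T" "v \<in> nbrs T x - core T"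
  then show "u = v" using pendant_unique[of u x v] mem_core[of u x] mem_core[of v x] by auto
qed

lemma card_nbrs_core:
  "card (nbrs T x) = card (nbrs T x \<inter> core T) + card (nbrs T x - core T)"
  using finite_nbrs[OF wf, of x] by (subst card_Un_disjoint[symmetric]) (auto simp: Int_Diff_Un)

text \<open>If \<open>u\<close> had degree 2, the leaf behind it would force its other neighbour
  \<open>x\<close> to have degree at least 4.\<close>

lemma pendant_of_small:
  assumes u: "u \<in> nbrs T x" "pendant T u" and x: "2 \<le> card (nbrs T x)" "card (nbrs T x) \<le> 3"
  shows "nbrs T u = {x}"
proof (rule ccontr)
  assume ne: "nbrs T u \<noteq> {x}"
  have xu: "x \<in> nbrs T u" using iffD1[OF nbrs_sym u(1)] .
  have "\<not> card (nbrs T u) \<le> 1"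
    using ne xu finite_nbrs[OF wf, of u] card_le_Suc0_iff_eq[of "nbrs T u"] by auto
  then obtain v where v: "v \<in> nbrs T u" "card (nbrs T v) = 1" and 2: "card (nbrs T u) = 2"
    using u(2) by (auto simp: pendant_def)
  have "u \<in> nbrs T v" using iffD1[OF nbrs_sym v(1)] .
  then have Nv: "nbrs T v = {u}" using v(2) by (auto simp: card_1_singleton_iff)
  have "v \<noteq> x" using v(2) x by auto
  then have "card {x, v} = card (nbrs T u)" using 2 by simp
  then have "{x, v} = nbrs T u"
    using xu v(1) finite_nbrs[OF wf] by (intro card_subset_eq) auto
  moreover obtain y where y: "y \<in> nbrs T u" "y \<noteq> v" "card (nbrs T y) \<ge> 4"
    using leaf_next_to_big[OF Nv] 2 by auto
  ultimately have "y = x" by blast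
  then show False using y(3) x(2) by simp
qed

text \<open>At most one neighbour is pendant, so a failure means degree 2 with one pendant
  neighbour; that neighbour is a leaf, which makes \<open>x\<close> pendant.\<close>

lemma core_degree:
  assumes "x \<in> core T"
  shows "card (nbrs T x \<inter> core T) \<ge> 2"
proof (rule ccontr)
  assume *: "\<not> ?thesis"
  have np: "\<not> pendant T x" using assms by (simp add: core_def)
  then have x2: "card (nbrs T x) = 2" "card (nbrs T x - core T) = 1"
    using * card_nbrs_core[of x] card_nbrs_diff_core[of x] by (auto simp: pendant_def)
  then obtain u where "nbrs T x - core T = {u}" by (auto simp: card_1_singleton_iff)
  then have u: "u \<in> nbrs T x" "u \<notin> core T" by auto
  then have "nbrs T u = {x}" using pendant_of_small[of u x] x2 mem_core by auto
  then have "card (nbrs T u) = 1" by simp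
  then have "pendant T x" using u(1) x2 unfolding pendant_def by blast
  then show False using np by simp
qed

text \<open>A pendant neighbour would be a leaf and force another neighbour of degree at least 4.
  That neighbour lies in the core and has at most one pendant neighbour, so its core degree is at
  least 3.\<close>

lemma thin_degree:
  assumes x: "x \<in> core T" "card (nbrs T x \<inter> core T) \<le> 2"
    and nb: "\<And>y. y \<in> nbrs T x \<inter> core T \<Longrightarrow> card (nbrs T y \<inter> core T) \<le> 2"
  shows "card (nbrs T x) = 2"
proof (rule ccontr)
  assume *: "\<not> ?thesis"
  then have x3: "card (nbrs T x) = 3" "card (nbrs T x - core T) = 1"
    using x(2) core_degree[OF x(1)] card_nbrs_core[of x] card_nbrs_diff_core[of x] by auto
  then obtain u where "nbrs T x - core T = {u}" by (auto simp: card_1_singleton_iff)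
  then have u: "u \<in> nbrs T x" "u \<notin> core T" by auto
  then have pu: "pendant T u" using mem_core by blast
  then have "nbrs T u = {x}" using u x3 by (intro pendant_of_small) auto
  then obtain y where y: "y \<in> nbrs T x" "y \<noteq> u" "card (nbrs T y) \<ge> 4"
    using leaf_next_to_big[of u x] x3 by auto
  have "y \<in> core T" using y pu u(1) pendant_unique mem_core by blast
  then show False
    using nb[of y] y card_nbrs_core[of y] card_nbrs_diff_core[of y] by auto
qed

text \<open>If no branch vertex is this close, \<open>x\<close> and a core neighbour
  \<open>a\<close> both have degree 2, and their neighbours have degree at most 3, so the edge
  between \<open>x\<close> and \<open>a\<close> could be folded.\<close>

lemma core_near_branch:
  assumes x: "x \<in> core T" "card (nbrs T x \<inter> core T) \<le> 2"
  shows "\<exists>a\<in>nbrs T x \<inter> core T. card (nbrs T a \<inter> core T) \<ge> 3 \<or>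
    (\<exists>b\<in>nbrs T a \<inter> core T. card (nbrs T b \<inter> core T) \<ge> 3)"
proof (rule ccontr)
  assume "\<not> ?thesis"
  then have near: "card (nbrs T a \<inter> core T) \<le> 2" "\<And>b. b \<in> nbrs T a \<inter> core T \<Longrightarrow>
      card (nbrs T b \<inter> core T) \<le> 2" if "a \<in> nbrs T x \<inter> core T" for a
    using that by (metis not_less_eq_eq numeral_2_eq_2 numeral_3_eq_3)+
  have "nbrs T x \<inter> core T \<noteq> {}" using core_degree[OF x(1)] by auto
  then obtain a where a: "a \<in> nbrs T x \<inter> core T" by blast
  have xa: "x \<in> nbrs T a" using a iffD1[OF nbrs_sym] by fastforce
  have dx: "card (nbrs T x) = 2" using x near(1) by (rule thin_degree)
  have da: "card (nbrs T a) = 2" using a near by (intro thin_degree) auto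
  have in_core: "nbrs T z \<subseteq> core T" if "z \<in> core T" "card (nbrs T z) = 2" for z
  proof -
    have "card (nbrs T z - core T) = 0"
      using core_degree[OF that(1)] that(2) card_nbrs_core[of z] by simp
    then show ?thesis using finite_nbrs[OF wf, of z] by (simp add: Diff_eq_empty_iff)
  qed
  have "card (nbrs T y) \<le> 3" if "y \<in> nbrs T x \<union> nbrs T a" for y
  proof -
    have "y \<in> core T" using that in_core[OF x(1) dx] in_core[OF _ da] a by blast
    then have "card (nbrs T y \<inter> core T) \<le> 2" using that near(1)[of y] near(2)[OF a, of y] by auto
    then show ?thesis using card_nbrs_core[of y] card_nbrs_diff_core[of y] by auto
  qed
  moreover have "card (nbrs T x \<union> nbrs T a - {x, a}) \<le> 3"
  proof -
    have "card (nbrs T x \<union> nbrs T a - {x, a}) = card (nbrs T x \<union> nbrs T a) - card {x, a}"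
      using a xa by (intro card_Diff_subset) auto
    moreover have "x \<noteq> a" using a nbrs_irrefl[OF wf, of x] by auto
    then have "card {x, a} = 2" by simp
    moreover have "card (nbrs T x \<union> nbrs T a) \<le> 4"
      using card_Un_le[of "nbrs T x" "nbrs T a"] dx da by simp
    ultimately show ?thesis by simp
  qed
  ultimately have "foldable T x a"
    using a xa nbrs_verts[OF wf xa] nbrs_irrefl[OF wf, of x] unfolding foldable_def by auto
  then show False using irred by blast
qed

text \<open>Sparseness bounds the number of branch vertices by \<open>2 * k\<close>, and every core
  vertex is within distance 2 of one. The three layers contribute \<open>2 * k\<close>,
  \<open>6 * k\<close> and \<open>12 * k\<close>.\<close>

lemma card_core_le:
  assumes sp: "sparse k T"
  shows "card (core T) \<le> 20 * k"
proof -
  let ?c = "\<lambda>x. card (nbrs T x \<inter> core T)"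
  let ?B = "{x \<in> core T. ?c x \<ge> 3}"
  have sub: "core T \<subseteq> verts T" by (auto simp: core_def)
  have fin: "finite (core T)" using sub finite_verts[OF wf] by (rule finite_subset)
  have finc: "finite (nbrs T x \<inter> core T)" for x using fin by simp
  have "(\<Sum>x\<in>core T. ?c x) = card (arcs T (core T))"
    unfolding arcs_def using fin finc by (simp add: card_SigmaI)
  also have "\<dots> \<le> 2 * card (core T) + 2 * k" using sp sub by (simp add: sparse_def)
  \<comment> \<open>Core degrees are at least 2, so the truncated subtraction is exact and the bound
    turns into one on the total excess over 2.\<close>
  also have "(\<Sum>x\<in>core T. ?c x) = (\<Sum>x\<in>core T. (?c x - 2) + 2)"
    by (intro sum.cong refl le_add_diff_inverse2[symmetric] core_degree)
  also have "\<dots> = (\<Sum>x\<in>core T. ?c x - 2) + 2 * card (core T)" by (subst sum.distrib) simp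
  finally have "(\<Sum>x\<in>core T. ?c x - 2) \<le> 2 * k" by simp
  moreover have "(\<Sum>x\<in>?B. ?c x - 2) \<le> (\<Sum>x\<in>core T. ?c x - 2)"
    using fin by (intro sum_mono2) auto
  ultimately have excess: "(\<Sum>x\<in>?B. ?c x - 2) \<le> 2 * k" by simp
  have "card ?B = (\<Sum>x\<in>?B. 1)" by simp
  also have "\<dots> \<le> (\<Sum>x\<in>?B. ?c x - 2)" by (intro sum_mono) auto
  finally have B: "card ?B \<le> 2 * k" using excess by simp
  let ?N1 = "\<Union>b\<in>?B. nbrs T b \<inter> core T"
  have "card ?N1 \<le> (\<Sum>b\<in>?B. ?c b)" using fin by (intro card_UN_le) simp
  \<comment> \<open>A core degree of at least 3 is at most three times its excess over 2.\<close>
  also have "\<dots> \<le> (\<Sum>b\<in>?B. 3 * (?c b - 2))" by (intro sum_mono) auto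
  also have "\<dots> \<le> 6 * k" using excess by (simp flip: sum_distrib_left)
  finally have N1: "card ?N1 \<le> 6 * k" .
  have finN1: "finite ?N1" using fin by auto
  let ?N2 = "\<Union>y\<in>?N1 - ?B. nbrs T y \<inter> core T"
  have "card ?N2 \<le> (\<Sum>y\<in>?N1 - ?B. ?c y)" using finN1 by (intro card_UN_le) simp
  also have "\<dots> \<le> (\<Sum>y\<in>?N1 - ?B. 2)" by (intro sum_mono) auto
  also have "\<dots> = 2 * card (?N1 - ?B)" by simp
  also have "\<dots> \<le> 2 * card ?N1" by (intro mult_le_mono2 card_mono finN1 Diff_subset)
  finally have N2: "card ?N2 \<le> 12 * k" using N1 by simp
  have "core T \<subseteq> ?B \<union> ?N1 \<union> ?N2"
  proof
    fix x assume x: "x \<in> core T"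
    show "x \<in> ?B \<union> ?N1 \<union> ?N2"
    proof (cases "x \<in> ?B")
      case False
      then have "?c x \<le> 2" using x by simp
      from core_near_branch[OF x this] obtain a where a: "a \<in> nbrs T x" "a \<in> core T"
        and near: "?c a \<ge> 3 \<or> (\<exists>b\<in>nbrs T a \<inter> core T. ?c b \<ge> 3)" by blast
      have xa: "x \<in> nbrs T a" using iffD1[OF nbrs_sym a(1)] .
      show ?thesis
      proof (cases "?c a \<ge> 3")
        case True
        then have "a \<in> ?B" using a by simp
        then show ?thesis using xa x by blast
      next
        case c: False
        then obtain b where b: "b \<in> nbrs T a" "b \<in> core T" "?c b \<ge> 3" using near by blast
        have "a \<in> nbrs T b" using iffD1[OF nbrs_sym b(1)] .
        moreover have "b \<in> ?B" using b by simp
        ultimately have "a \<in> ?N1 - ?B" using a c by blast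
        then show ?thesis using xa x by blast
      qed
    qed simp
  qed
  then have "card (core T) \<le> card (?B \<union> ?N1 \<union> ?N2)"
    using fin by (intro card_mono) auto
  also have "\<dots> \<le> card ?B + card ?N1 + card ?N2"
    by (meson add_le_mono1 card_Un_le le_trans)
  finally show ?thesis using B N1 N2 by simp
qed

text \<open>Besides the core there are at most one isolated vertex, since two could be folded, the
  pendant vertices \<open>?P1\<close> attached to the core, and those attached to
  \<open>?P1\<close>. Uniqueness of pendant neighbours bounds both layers by the size of the
  core.\<close>

lemma card_verts_le:
  assumes sp: "sparse k T"
  shows "card (verts T) \<le> 80 * k + 1"
proof -
  have sub: "core T \<subseteq> verts T" by (auto simp: core_def)
  have fin: "finite (core T)" using sub finite_verts[OF wf] by (rule finite_subset)
  let ?Z = "{x \<in> verts T. nbrs T x = {}}"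
  have Z: "card ?Z \<le> 1"
  proof (rule card_le_1I)
    fix u v assume "u \<in> ?Z" "v \<in> ?Z"
    then show "u = v" using irred[of u v] by (auto simp: foldable_def)
  qed
  let ?P1 = "\<Union>x\<in>core T. nbrs T x - core T"
  have "card ?P1 \<le> (\<Sum>x\<in>core T. card (nbrs T x - core T))" using fin by (rule card_UN_le)
  also have "\<dots> \<le> (\<Sum>x\<in>core T. 1)" by (intro sum_mono card_nbrs_diff_core)
  finally have P1: "card ?P1 \<le> card (core T)" by simp
  have finP1: "finite ?P1" using fin finite_nbrs[OF wf] by auto
  let ?P2 = "\<Union>u\<in>?P1. nbrs T u - core T"
  have "card ?P2 \<le> (\<Sum>u\<in>?P1. card (nbrs T u - core T))" using finP1 by (rule card_UN_le)
  also have "\<dots> \<le> (\<Sum>u\<in>?P1. 1)" by (intro sum_mono card_nbrs_diff_core)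
  finally have P2: "card ?P2 \<le> card (core T)" using P1 by simp
  have "verts T \<subseteq> core T \<union> ?Z \<union> ?P1 \<union> ?P2"
  proof
    fix x assume x: "x \<in> verts T"
    show "x \<in> core T \<union> ?Z \<union> ?P1 \<union> ?P2"
    proof (cases "x \<in> core T \<or> nbrs T x = {}")
      case False
      then have xc: "x \<notin> core T" and p: "pendant T x" using x by (auto simp: core_def)
      have big: "y \<in> core T" if "y \<in> nbrs T z" "card (nbrs T y) \<ge> 4" for y z
        using that by (auto simp: mem_core pendant_def)
      have P1I: "z \<in> ?P1" if "y \<in> nbrs T z" "y \<in> core T" "z \<notin> core T" for y z
        using that iffD1[OF nbrs_sym that(1)] by blast
      show ?thesis
      proof (cases "card (nbrs T x) \<le> 1")
        case True
        then have "card (nbrs T x) = 1"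
          using False finite_nbrs[OF wf, of x] by (simp add: le_Suc_eq)
        then obtain u where u: "nbrs T x = {u}" by (auto simp: card_1_singleton_iff)
        then have ux: "u \<in> nbrs T x" by simp
        have xu: "x \<in> nbrs T u" using iffD1[OF nbrs_sym ux] .
        show ?thesis
        proof (cases "u \<in> core T")
          case True
          then show ?thesis using P1I[OF ux] xc by blast
        next
          case uc: False
          \<comment> \<open>A leaf next to a pendant \<open>u\<close>: \<open>u\<close> must have a
            neighbour of degree at least 4, hence in the core, so the leaf lies in the second
            layer.\<close>
          then have "card (nbrs T u) \<le> 4" using mem_core[OF ux] by (auto simp: pendant_def)
          then obtain y where "y \<in> nbrs T u" "card (nbrs T y) \<ge> 4"
            using leaf_next_to_big[OF u] by blast
          then have "u \<in> ?P1" using big P1I uc by blast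
          then show ?thesis using xu xc by blast
        qed
      next
        case False
        then obtain v where v: "v \<in> nbrs T x" "card (nbrs T v) = 1" and 2: "card (nbrs T x) = 2"
          using p by (auto simp: pendant_def)
        have "x \<in> nbrs T v" using iffD1[OF nbrs_sym v(1)] .
        then have "nbrs T v = {x}" using v(2) by (auto simp: card_1_singleton_iff)
        then obtain y where "y \<in> nbrs T x" "card (nbrs T y) \<ge> 4"
          using leaf_next_to_big[of v x] 2 by auto
        then have "x \<in> ?P1" using big P1I xc by blast
        then show ?thesis by blast
      qed
    qed (use x in auto)
  qed
  then have "card (verts T) \<le> card (core T \<union> ?Z \<union> ?P1 \<union> ?P2)"
    using fin finP1 finite_verts[OF wf] finite_nbrs[OF wf] by (intro card_mono) auto
  also have "\<dots> \<le> card (core T) + card ?Z + card ?P1 + card ?P2"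
    by (meson add_le_mono1 card_Un_le le_trans)
  finally show ?thesis using card_core_le[OF sp] Z P1 P2 by simp
qed

end

section \<open>From feedback edges to sparseness\<close>

lemma exists_max_path:
  fixes E :: "'a set set"
  assumes "finite S" "S \<noteq> {}"
  defines "P \<equiv> \<lambda>p. p \<noteq> [] \<and> distinct p \<and> set p \<subseteq> S \<and>
    (\<forall>i. Suc i < length p \<longrightarrow> {p ! i, p ! Suc i} \<in> E)"
  shows "\<exists>p. P p \<and> (\<forall>q. P q \<longrightarrow> length q \<le> length p)"
proof -
  obtain x where "x \<in> S" using assms(2) by blast
  then have "P [x]" by (simp add: P_def)
  moreover have "\<forall>p. P p \<longrightarrow> length p < Suc (card S)"
  proof (intro allI impI)
    fix p assume "P p"
    then have "card (set p) = length p" "set p \<subseteq> S" by (simp_all add: P_def distinct_card)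
    then show "length p < Suc (card S)" using card_mono[OF assms(1)] by (metis less_Suc_eq_le)
  qed
  ultimately show ?thesis by (rule ex_has_greatest_nat)
qed

text \<open>All neighbours of the first vertex of a longest path lie on the path; one that is not
  its successor closes a prefix to a cycle.\<close>

lemma cycle_if_min_degree_2:
  assumes S: "finite S" "S \<noteq> {}" and E: "\<And>e. e \<in> E \<Longrightarrow> e \<subseteq> S \<and> card e = 2"
    and deg: "\<And>x. x \<in> S \<Longrightarrow> \<exists>y z. y \<noteq> z \<and> {x, y} \<in> E \<and> {x, z} \<in> E"
  shows "\<not> acyclic_edges E"
proof -
  obtain p where p: "p \<noteq> []" "distinct p" "set p \<subseteq> S"
      "\<And>i. Suc i < length p \<Longrightarrow> {p ! i, p ! Suc i} \<in> E"
    and max: "\<And>q. q \<noteq> [] \<Longrightarrow> distinct q \<Longrightarrow> set q \<subseteq> S \<Longrightarrow>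
      (\<And>i. Suc i < length q \<Longrightarrow> {q ! i, q ! Suc i} \<in> E) \<Longrightarrow> length q \<le> length p"
    using exists_max_path[OF S, of E] by blast
  define x where "x = p ! 0"
  have "x \<in> S" using p(1,3) by (auto simp: x_def)
  then obtain y z where yz: "y \<noteq> z" "{x, y} \<in> E" "{x, z} \<in> E" using deg by blast
  have wrap: "\<exists>i. 0 < i \<and> i < length p \<and> p ! i = w" if w: "{x, w} \<in> E" for w
  proof -
    have "x \<noteq> w" "w \<in> S" using E[OF w] by auto
    have "w \<in> set p"
    proof (rule ccontr)
      assume wp: "w \<notin> set p"
      have "length (w # p) \<le> length p"
      proof (rule max)
        show "{(w # p) ! i, (w # p) ! Suc i} \<in> E" if "Suc i < length (w # p)" for i
          using that w p(4) by (cases i) (simp_all add: x_def insert_commute)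
      qed (use wp p \<open>w \<in> S\<close> in auto)
      then show False by simp
    qed
    then obtain i where "i < length p" "p ! i = w" by (auto simp: in_set_conv_nth)
    then show ?thesis using \<open>x \<noteq> w\<close> by (intro exI[of _ i]) (auto simp: x_def intro: gr0I)
  qed
  obtain i where i: "0 < i" "i < length p" "p ! i = y" using wrap[OF yz(2)] by blast
  obtain j where j: "0 < j" "j < length p" "p ! j = z" using wrap[OF yz(3)] by blast
  have "\<exists>m\<ge>2. m < length p \<and> {p ! m, x} \<in> E"
  proof (cases "i \<ge> 2")
    case True
    then show ?thesis using i yz(2) by (intro exI[of _ i]) (simp add: insert_commute)
  next
    case False
    then have "i = 1" using i by simp
    then have "j \<noteq> 1" using i j yz(1) by auto
    then show ?thesis using j yz(3) by (intro exI[of _ j]) (simp add: insert_commute)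
  qed
  then obtain m where m: "m \<ge> 2" "m < length p" "{p ! m, x} \<in> E" by blast
  have "is_cycle E (take (Suc m) p)"
    using m p(1,2,4) min_absorb2[of "Suc m" "length p"] unfolding is_cycle_def
    by (simp add: last_conv_nth hd_conv_nth x_def)
  then show ?thesis unfolding acyclic_edges_def by blast
qed

lemma acyclic_edges_mono: "acyclic_edges E \<Longrightarrow> D \<subseteq> E \<Longrightarrow> acyclic_edges D"
  unfolding acyclic_edges_def is_cycle_def by blast

text \<open>Acyclicity yields a vertex with at most one incident edge; removing it costs one vertex
  and at most one edge.\<close>

lemma card_acyclic_edges:
  assumes "finite S" "\<And>e. e \<in> E \<Longrightarrow> e \<subseteq> S \<and> card e = 2" "acyclic_edges E"
  shows "card E \<le> card S"
  using assms
proof (induction "card S" arbitrary: S E rule: less_induct)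
  case less
  show ?case
  proof (cases "S = {}")
    case True
    then have "E = {}" using less.prems(2) by fastforce
    then show ?thesis by simp
  next
    case False
    have "\<exists>x\<in>S. \<forall>y z. {x, y} \<in> E \<longrightarrow> {x, z} \<in> E \<longrightarrow> y = z"
    proof (rule ccontr)
      assume *: "\<not> ?thesis"
      have "\<not> acyclic_edges E"
      proof (rule cycle_if_min_degree_2[OF less.prems(1) False less.prems(2)])
        show "\<exists>y z. y \<noteq> z \<and> {x, y} \<in> E \<and> {x, z} \<in> E" if "x \<in> S" for x
          using * that by blast
      qed
      then show False using less.prems(3) by simp
    qed
    then obtain x where x: "x \<in> S" "\<And>y z. {x, y} \<in> E \<Longrightarrow> {x, z} \<in> E \<Longrightarrow> y = z" by blast
    let ?E = "{e \<in> E. x \<notin> e}"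
    have finE: "finite E"
      using less.prems(1,2) by (intro finite_subset[of E "Pow S"]) auto
    have "card {e \<in> E. x \<in> e} \<le> 1"
    proof (rule card_le_1I)
      have pair: "\<exists>y. e = {x, y}" if "e \<in> {e \<in> E. x \<in> e}" for e
      proof -
        have "card e = 2" "x \<in> e" using that less.prems(2) by auto
        then obtain a b where "e = {a, b}" by (auto simp: card_2_iff)
        then show ?thesis using \<open>x \<in> e\<close> by auto
      qed
      fix e f assume ef: "e \<in> {e \<in> E. x \<in> e}" "f \<in> {e \<in> E. x \<in> e}"
      then obtain y z where "e = {x, y}" "f = {x, z}" using pair by metis
      then show "e = f" using x(2)[of y z] ef by simp
    qed
    moreover have "card ?E \<le> card (S - {x})"
    proof (rule less.hyps)
      show "card (S - {x}) < card S" using less.prems(1) x(1) by (rule card_Diff1_less)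
      show "e \<subseteq> S - {x} \<and> card e = 2" if "e \<in> ?E" for e using that less.prems(2) by blast
      show "acyclic_edges ?E" using less.prems(3) by (rule acyclic_edges_mono) blast
    qed (use less.prems(1) in simp)
    moreover have "card ({e \<in> E. x \<in> e} \<union> ?E) = card {e \<in> E. x \<in> e} + card ?E"
      using finE by (intro card_Un_disjoint) auto
    moreover have "{e \<in> E. x \<in> e} \<union> ?E = E" by blast
    moreover have "Suc (card (S - {x})) = card S"
      using less.prems(1) x(1) by (rule card_Suc_Diff1)
    ultimately show ?thesis by simp
  qed
qed

text \<open>Inside any \<open>S\<close>, the edges outside a minimum feedback set are acyclic, hence
  at most \<open>card S\<close>; the feedback set adds at most its own size.\<close>

lemma sparse_trigraph_of:
  assumes G: "simple_graph V E"
  shows "sparse (feedback_edge_number E) (trigraph_of V E)"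
  unfolding sparse_def
proof (intro allI impI)
  obtain F where F: "F \<subseteq> E" "acyclic_edges (E - F)" "card F = feedback_edge_number E"
    using feedback_edge_number_attained by metis
  fix S assume "S \<subseteq> verts (trigraph_of V E)"
  then have S: "finite S"
    using G unfolding simple_graph_def trigraph_of_def by (auto intro: finite_subset)
  let ?D = "{e \<in> E. e \<subseteq> S}"
  have finE: "finite E" using G by (rule simple_graph_finite_edges)
  have "card (?D - F) \<le> card S"
  proof (rule card_acyclic_edges[OF S])
    show "e \<subseteq> S \<and> card e = 2" if "e \<in> ?D - F" for e using that G by (auto simp: simple_graph_def)
    show "acyclic_edges (?D - F)" using F(2) by (rule acyclic_edges_mono) blast
  qed
  moreover have "card ?D \<le> card (?D - F) + card F"
  proof -
    have "card ?D \<le> card ((?D - F) \<union> F)"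
      using finE F(1) finite_subset by (intro card_mono) auto
    then show ?thesis using card_Un_le le_trans by blast
  qed
  ultimately have D: "card ?D \<le> card S + feedback_edge_number E" using F(3) by simp
  have arcs: "arcs (trigraph_of V E) S \<subseteq> (\<Union>e\<in>?D. {(x, y). x \<noteq> y \<and> {x, y} = e})"
  proof
    fix a assume "a \<in> arcs (trigraph_of V E) S"
    then obtain x y where a: "a = (x, y)" "x \<in> S" "y \<in> S" "{x, y} \<in> E"
      by (auto simp: arcs_def nbrs_def trigraph_of_def)
    have "card {x, y} = 2" using G a(4) by (simp add: simple_graph_def)
    then have "x \<noteq> y" by auto
    with a show "a \<in> (\<Union>e\<in>?D. {(x, y). x \<noteq> y \<and> {x, y} = e})" by auto
  qed
  have pairs: "finite {(x, y). x \<noteq> y \<and> {x, y} = e} \<and>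
      card {(x, y). x \<noteq> y \<and> {x, y} = e} \<le> 2" if e: "e \<in> ?D" for e
  proof -
    have "card e = 2" using e G by (simp add: simple_graph_def)
    then obtain a b where "e = {a, b}" by (auto simp: card_2_iff)
    have sub: "{(x, y). x \<noteq> y \<and> {x, y} = e} \<subseteq> {(a, b), (b, a)}"
      unfolding \<open>e = {a, b}\<close> doubleton_eq_iff by blast
    have "card {(x, y). x \<noteq> y \<and> {x, y} = e} \<le> card {(a, b), (b, a)}"
      using sub by (rule card_mono[rotated]) simp
    also have "\<dots> \<le> 2" using card_length[of "[(a, b), (b, a)]"] by simp
    finally show ?thesis using finite_subset[OF sub] by blast
  qed
  have finD: "finite ?D" using finE by simp
  then have "finite (\<Union>e\<in>?D. {(x, y). x \<noteq> y \<and> {x, y} = e})"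
    using pairs by (intro finite_UN_I) blast+
  then have "card (arcs (trigraph_of V E) S) \<le>
      card (\<Union>e\<in>?D. {(x, y). x \<noteq> y \<and> {x, y} = e})"
    using arcs by (rule card_mono)
  also have "\<dots> \<le> (\<Sum>e\<in>?D. card {(x, y). x \<noteq> y \<and> {x, y} = e})"
    using finD by (rule card_UN_le)
  also have "\<dots> \<le> (\<Sum>e\<in>?D. 2)" using pairs by (intro sum_mono) blast
  also have "\<dots> = 2 * card ?D" by simp
  finally show "card (arcs (trigraph_of V E) S) \<le> 2 * card S + 2 * feedback_edge_number E"
    using D by simp
qed

section \<open>The final bound: reduce by folding, then group\<close>

lemma card_red_nbrs_tame:
  assumes "wf_trigraph T" "tame T"
  shows "card (red_nbrs T x) \<le> 3"
proof (cases "red_nbrs T x = {}")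
  case False
  have "card (red_nbrs T x) \<le> card (nbrs T x)"
    by (rule card_mono[OF finite_nbrs[OF assms(1)] red_nbrs_subset])
  also have "\<dots> \<le> 3" using assms(2) False by (simp add: tame_def)
  finally show ?thesis .
qed simp

lemma tww_le_sparse:
  assumes "wf_trigraph T" "verts T \<noteq> {}" "tame T" "sparse k T"
    and s: "s > 0" "162 * k + 2 \<le> s * s"
  shows "tww_le (2 * s + 4) T"
  using assms(1-4)
proof (induction "card (verts T)" arbitrary: T rule: less_induct)
  case less
  note wf = less.prems(1)
  show ?case
  proof (cases "\<exists>u v. foldable T u v")
    case True
    then obtain u v where fold: "foldable T u v" by blast
    then have uv: "u \<in> verts T" "v \<in> verts T" "u \<noteq> v" by (auto simp: foldable_def)
    note c = wf uv
    have "tww_le (2 * s + 4) (contract u v u T)"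
    proof (rule less.hyps)
      show "card (verts (contract u v u T)) < card (verts T)"
        unfolding verts_contract[OF c] using finite_verts[OF wf] uv(2) by (rule card_Diff1_less)
      show "verts (contract u v u T) \<noteq> {}" unfolding verts_contract[OF c] using uv by blast
    qed (use wf_contract[OF c] tame_contract[OF wf _ fold] sparse_contract[OF wf _ fold]
        less.prems(3,4) in auto)
    moreover have "red_degree T x \<le> 2 * s + 4" for x
      using card_red_nbrs_tame[OF wf less.prems(3), of x] by (simp add: red_degree_eq[OF wf])
    ultimately show ?thesis by (intro tww_le_step[OF _ contraction_contract[OF c]])
  next
    case False
    then have "card (verts T) \<le> 80 * k + 1" using card_verts_le[OF wf _ less.prems(4)] by blast
    moreover have "(\<Sum>x\<in>verts T. card (nbrs T x)) = card (arcs T (verts T))"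
    proof -
      have "nbrs T x \<inter> verts T = nbrs T x" for x using nbrs_verts[OF wf] by blast
      then show ?thesis
        unfolding arcs_def using finite_verts[OF wf] finite_nbrs[OF wf] by (simp add: card_SigmaI)
    qed
    moreover have "card (arcs T (verts T)) \<le> 2 * card (verts T) + 2 * k"
      using less.prems(4) by (simp add: sparse_def)
    \<comment> \<open>The degree sum is at most \<open>2 * (80 * k + 1) + 2 * k\<close>, which is
      \<open>162 * k + 2\<close>.\<close>
    ultimately have sum: "(\<Sum>x\<in>verts T. card (nbrs T x)) \<le> s * s" using s(2) by simp
    show ?thesis
      \<comment> \<open>Start without groups, with degrees as weights and \<open>q = s\<close>; the
        width condition then reads \<open>3 + s + 1 \<le> 2 * s + 4\<close>.\<close>
      by (rule tww_le_grouping[where N = "{}" and c = 3, OF wf less.prems(2) le_refl sum])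
        (use card_red_nbrs_tame[OF wf less.prems(3)] s(1) in auto)
  qed
qed

theorem theorem8:
  "\<exists>f :: nat \<Rightarrow> real. f \<in> O(\<lambda>k. sqrt (real k)) \<and>
     (\<forall>(V :: 'a set) E k. simple_graph V E \<and> V \<noteq> {} \<and> feedback_edge_number E = k \<longrightarrow>
        real (twin_width (trigraph_of V E)) \<le> f k)"
proof (intro exI conjI allI impI)
  let ?f = "\<lambda>k. 2 * (sqrt (162 * real k + 2) + 1) + 4"
  have "norm (?f k) \<le> 34 * norm (sqrt (real k))" if k: "k \<ge> 1" for k
  proof -
    \<comment> \<open>For \<open>k \<ge> 1\<close>, \<open>162 * k + 2\<close> is below
      \<open>196 * k\<close>, where 196 is the square of 14. The additive 1 and 4 are absorbed by
      \<open>sqrt k \<ge> 1\<close>, giving the factor 34.\<close>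
    have "sqrt (162 * real k + 2) \<le> sqrt (14\<^sup>2 * real k)" using k by (intro real_sqrt_le_mono) simp
    also have "\<dots> = 14 * sqrt (real k)" by (simp add: real_sqrt_mult)
    finally have "sqrt (162 * real k + 2) \<le> 14 * sqrt (real k)" .
    moreover have "sqrt (real k) \<ge> 1" using k by simp
    ultimately have "?f k \<le> 2 * (14 * sqrt (real k) + sqrt (real k)) + 4 * sqrt (real k)"
      by (intro add_mono mult_left_mono) simp_all
    then have "?f k \<le> 34 * sqrt (real k)" by simp
    then show ?thesis by simp
  qed
  then show "?f \<in> O(\<lambda>k. sqrt (real k))"
    by (intro bigoI[of _ 34] eventually_sequentiallyI[of 1])
  fix V :: "'a set" and E k
  assume "simple_graph V E \<and> V \<noteq> {} \<and> feedback_edge_number E = k"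
  then have G: "simple_graph V E" "V \<noteq> {}" "feedback_edge_number E = k" by auto
  \<comment> \<open>Rounding up makes \<open>s * s\<close> large enough and exceeds the root by at
    most 1, which accounts for the \<open>+ 1\<close> in the bound.\<close>
  define s where "s = nat \<lceil>sqrt (162 * real k + 2)\<rceil>"
  have "sqrt (162 * real k + 2) > 0" by simp
  then have s: "sqrt (162 * real k + 2) \<le> real s" "real s \<le> sqrt (162 * real k + 2) + 1" "s > 0"
    unfolding s_def by linarith+
  have "162 * real k + 2 = sqrt (162 * real k + 2) * sqrt (162 * real k + 2)" by simp
  also have "\<dots> \<le> real s * real s" using s by (intro mult_mono) auto
  finally have "real (162 * k + 2) \<le> real (s * s)" by simp
  then have ss: "162 * k + 2 \<le> s * s" by (simp only: of_nat_le_iff)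
  have "tww_le (2 * s + 4) (trigraph_of V E)"
  proof (rule tww_le_sparse[OF _ _ _ _ s(3) ss])
    show "tame (trigraph_of V E)" by (simp add: tame_def red_nbrs_def trigraph_of_def)
    show "sparse k (trigraph_of V E)" using sparse_trigraph_of[OF G(1)] G(3) by simp
  qed (use G wf_trigraph_of in \<open>auto simp: trigraph_of_def\<close>)
  then have "real (twin_width (trigraph_of V E)) \<le> real (2 * s + 4)"
    using twin_width_le by (simp only: of_nat_le_iff)
  then show "real (twin_width (trigraph_of V E)) \<le> ?f k" using s(2) by simp
qed

end
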